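(* Let $\mathbb{F}$ be a field and $m\ge 1$. Let $a,b,c,d,e,f,g,h,i,j,k\in M_m(\mathbb{F})$ be invertible (known) matrices such that the $2m\times 2m$ block matrix $\begin{pmatrix} a & b \\ d & e \end{pmatrix}$ is also invertible. For (unknown) matrices $t,u,v,w,x,y,z\in M_m(\mathbb{F})$ consider the block matrices $$A=\begin{pmatrix} a & t & b \\ u & c & v \\ d & w & e \end{pmatrix},\qquad B=\begin{pmatrix} x & f & g \\ h & y & i \\ j & k & z \end{pmatrix}.$$ Put $$\tilde p=-a^{-1}h^{-1}i+a^{-1}bjh^{-1}i-d^{-1}-d^{-1}ejh^{-1}i,$$ $$\tilde q=-kf^{-1}a^{-1}+kf^{-1}gda^{-1}-b^{-1}-kf^{-1}geb^{-1},$$ and $M=a^{-1}b-d^{-1}e$, $N=da^{-1}-eb^{-1}$ (both $M$ and $N$ are invertible, because $a,b,d,e$ and the block matrix $\begin{pmatrix} a & b \\ d & e \end{pmatrix}$ are invertible). Then there exist $t,u,v,w,x,y,z\in M_m(\mathbb{F})$ with $AB=I$ and $BA=I$ if and only if the known matrices satisfy the following three conditions: $$\tilde p\,N=M\,\tilde q,$$ $$\tilde qN^{-1}=\tilde qN^{-1}\,e\,\tilde qN^{-1}+\tilde qN^{-1}\,dg+jb\,\tilde qN^{-1}-kci+jag,$$ $$M^{-1}\tilde p=M^{-1}\tilde p\,e\,M^{-1}\tilde p+M^{-1}\tilde p\,dg+jb\,M^{-1}\tilde p-kci+jag.$$ In that case the unknown matrices are given by $$z=M^{-1}\tilde p,\quad\text{or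 equivalently}\quad z=\tilde qN^{-1},$$ and then $$t=-agi^{-1}-bzi^{-1},\qquad u=-k^{-1}ja-k^{-1}zd,$$ $$v=k^{-1}-k^{-1}jb-k^{-1}ze,\qquad w=i^{-1}-dgi^{-1}-ezi^{-1},$$ $$x=a^{-1}+fk^{-1}j-gda^{-1}+fk^{-1}zda^{-1},$$ $$y=c^{-1}k^{-1}jaf+c^{-1}k^{-1}jbk+c^{-1}k^{-1}zdf+c^{-1}k^{-1}zek.$$
   Context: $M_m(\mathbb{F})$ denotes the $m\times m$ matrices over $\mathbb{F}$, and $I$ is the $3m\times 3m$ identity matrix. The letters $i,j,k$ denote matrices (blocks of $B$), not indices. The problem is a completion problem: the blocks $a,\dots,k$ are prescribed and the blocks $t,\dots,z$ are to be filled in so that $A$ and $B$ are inverses of each other. *)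

theory Defs
  imports "HOL-Analysis.Analysis"
begin

text \<open>
  Square matrices of size m over a field are rendered as \<^typ>\<open>'a^'n^'n\<close> with m the cardinality
  of the index type \<^typ>\<open>'n::finite\<close>. Block matrices are indexed by disjoint sums of copies of
  that type; \<open>Inl\<close> is the first block row (column), and in \<open>'n + 'n + 'n\<close>, which nests to the
  right, \<open>Inr (Inl _)\<close> and \<open>Inr (Inr _)\<close> are the second and the third.
\<close>

notation matrix_inv (\<open>(_\<^sup>-\<^sup>1)\<close> [1000] 999)

definition block2 ::
  "'a^'n^'n \<Rightarrow> 'a^'n^'n \<Rightarrow>
   'a^'n^'n \<Rightarrow> 'a^'n^'n \<Rightarrow> 'a^('n + 'n)^('n + 'n)"
  where
  "block2 a11 a12 a21 a22 =
    (\<chi> r s. case r of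
        Inl r1 \<Rightarrow> (case s of Inl s1 \<Rightarrow> a11 $ r1 $ s1 | Inr s2 \<Rightarrow> a12 $ r1 $ s2)
      | Inr r2 \<Rightarrow> (case s of Inl s1 \<Rightarrow> a21 $ r2 $ s1 | Inr s2 \<Rightarrow> a22 $ r2 $ s2))"

definition block3 ::
  "'a^'n^'n \<Rightarrow> 'a^'n^'n \<Rightarrow> 'a^'n^'n \<Rightarrow>
   'a^'n^'n \<Rightarrow> 'a^'n^'n \<Rightarrow> 'a^'n^'n \<Rightarrow>
   'a^'n^'n \<Rightarrow> 'a^'n^'n \<Rightarrow> 'a^'n^'n \<Rightarrow> 'a^('n + 'n + 'n)^('n + 'n + 'n)"
  where
  "block3 a11 a12 a13 a21 a22 a23 a31 a32 a33 =
    (\<chi> r s. case r of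
        Inl r1 \<Rightarrow>
          (case s of Inl s1 \<Rightarrow> a11 $ r1 $ s1
           | Inr (Inl s2) \<Rightarrow> a12 $ r1 $ s2 | Inr (Inr s3) \<Rightarrow> a13 $ r1 $ s3)
      | Inr (Inl r2) \<Rightarrow>
          (case s of Inl s1 \<Rightarrow> a21 $ r2 $ s1
           | Inr (Inl s2) \<Rightarrow> a22 $ r2 $ s2 | Inr (Inr s3) \<Rightarrow> a23 $ r2 $ s3)
      | Inr (Inr r3) \<Rightarrow>
          (case s of Inl s1 \<Rightarrow> a31 $ r3 $ s1
           | Inr (Inl s2) \<Rightarrow> a32 $ r3 $ s2 | Inr (Inr s3) \<Rightarrow> a33 $ r3 $ s3))"

end

theory Submission
  imports Defs
begin

text \<open>
  Write \<open>a, t, \<dots>, e\<close> for the blocks of \<open>A\<close> and \<open>x, f, \<dots>, z\<close> for those of \<open>B\<close>. The third block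
  column of \<open>A ** B = mat 1\<close> and the third block row of \<open>B ** A = mat 1\<close> determine \<open>t\<close>, \<open>w\<close>, \<open>u\<close>, \<open>v\<close>
  from \<open>z\<close>, and each leaves the same quadratic equation in \<open>z\<close>. Computing \<open>x\<close> in two ways from the
  first block column of \<open>A ** B = mat 1\<close> amounts to \<open>M ** z = p\<close>, and from the first block row of
  \<open>B ** A = mat 1\<close> to \<open>z ** N = q\<close>. Conversely, these equations yield the first and third block rows
  and columns of the inverse; the middle column is then
  \<open>(E\<^sub>2 - C\<^sub>1 ** t - C\<^sub>3 ** w) ** c\<^sup>-\<^sup>1\<close>, where \<open>C\<^sub>1\<close>, \<open>C\<^sub>3\<close> are
  the outer columns and \<open>E\<^sub>2\<close> is the middle column of \<open>mat 1\<close>.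
\<close>

section \<open>Ring laws and cancellation of inverses for matrices\<close>

lemma matrix_add_rdistrib:
  fixes A B :: "'a::semiring_1^'n^'m"
  shows "(A + B) ** C = A ** C + B ** C"
  by (vector matrix_matrix_mult_def sum.distrib[symmetric] distrib_right)

lemma matrix_diff_ldistrib:
  fixes B C :: "'a::ring_1^'p^'n"
  shows "A ** (B - C) = A ** B - A ** C"
  by (vector matrix_matrix_mult_def sum_subtractf[symmetric] right_diff_distrib)

lemma matrix_diff_rdistrib:
  fixes A B :: "'a::ring_1^'n^'m"
  shows "(A - B) ** C = A ** C - B ** C"
  by (vector matrix_matrix_mult_def sum_subtractf[symmetric] left_diff_distrib)

lemma matrix_minus_left:
  fixes A :: "'a::ring_1^'n^'m"
  shows "(- A) ** B = - (A ** B)"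
  by (vector matrix_matrix_mult_def sum_negf)

lemma matrix_minus_right:
  fixes A :: "'a::ring_1^'n^'m"
  shows "A ** (- B) = - (A ** B)"
  by (vector matrix_matrix_mult_def sum_negf)

lemmas matrix_ring_simps =
  matrix_add_ldistrib matrix_add_rdistrib matrix_diff_ldistrib matrix_diff_rdistrib
  matrix_minus_left matrix_minus_right matrix_mul_assoc[symmetric]

lemma matrix_inv:
  fixes A :: "'a::semiring_1^'n^'m"
  assumes "invertible A"
  shows "A ** A\<^sup>-\<^sup>1 = mat 1" "A\<^sup>-\<^sup>1 ** A = mat 1"
  using someI_ex[OF assms[unfolded invertible_def]] by (simp_all add: matrix_inv_def)

text \<open>The rules fit right-nested products, the normal form of
  \<open>matrix_ring_simps\<close>, so inverses also cancel in the middle of longer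
  products.\<close>

lemma matrix_inv_mult_cancel:
  fixes A :: "'a::semiring_1^'n^'n"
  assumes "invertible A"
  shows "A\<^sup>-\<^sup>1 ** (A ** X) = X" "A ** (A\<^sup>-\<^sup>1 ** X) = X"
    "A\<^sup>-\<^sup>1 ** A = mat 1" "A ** A\<^sup>-\<^sup>1 = mat 1"
  using matrix_inv[OF assms] by (simp_all add: matrix_mul_assoc)

lemma matrix_eq_mult_inv_iff:
  fixes A :: "'a::semiring_1^'n^'n"
  assumes "invertible A"
  shows "X = Y ** A\<^sup>-\<^sup>1 \<longleftrightarrow> X ** A = Y"
  using matrix_inv[OF assms] by (metis matrix_mul_assoc matrix_mul_rid)

lemma matrix_eq_inv_mult_iff:
  fixes A :: "'a::semiring_1^'n^'n"
  assumes "invertible A"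
  shows "X = A\<^sup>-\<^sup>1 ** Y \<longleftrightarrow> A ** X = Y"
  using matrix_inv[OF assms] by (metis matrix_mul_assoc matrix_mul_lid)

section \<open>Block matrices\<close>

lemma sum_UNIV_Plus:
  "(\<Sum>x\<in>(UNIV :: ('m::finite + 'n::finite) set). F x)
    = (\<Sum>x\<in>UNIV. F (Inl x)) + (\<Sum>x\<in>UNIV. F (Inr x))"
  using sum.Plus[of "UNIV :: 'm set" "UNIV :: 'n set" F] by simp

lemma block2_mult:
  fixes a b c d :: "'a::semiring_1^'n^'n"
  shows "block2 a b c d ** block2 a' b' c' d' =
    block2 (a ** a' + b ** c') (a ** b' + b ** d') (c ** a' + d ** c') (c ** b' + d ** d')"
  by (simp add: vec_eq_iff block2_def matrix_matrix_mult_def sum_UNIV_Plus split: sum.splits)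

lemma mat_1_block2: "mat 1 = block2 (mat 1) 0 0 (mat 1)"
  by (auto simp: vec_eq_iff block2_def mat_def split: sum.splits)

lemma block2_eq_iff:
  "block2 a b c d = block2 a' b' c' d' \<longleftrightarrow> a = a' \<and> b = b' \<and> c = c' \<and> d = d'"
  by (auto simp: vec_eq_iff block2_def split: sum.splits)

lemma block2_cases:
  obtains a b c d where "A = block2 a b c d"
proof
  show "A = block2 (\<chi> r s. A $ Inl r $ Inl s) (\<chi> r s. A $ Inl r $ Inr s)
      (\<chi> r s. A $ Inr r $ Inl s) (\<chi> r s. A $ Inr r $ Inr s)"
    by (simp add: vec_eq_iff block2_def split: sum.splits)
qed

lemma block3_mult:
  fixes a11 a12 a13 a21 a22 a23 a31 a32 a33 :: "'a::semiring_1^'n^'n"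
  shows "block3 a11 a12 a13 a21 a22 a23 a31 a32 a33 ** block3 b11 b12 b13 b21 b22 b23 b31 b32 b33 =
    block3
      (a11 ** b11 + a12 ** b21 + a13 ** b31) (a11 ** b12 + a12 ** b22 + a13 ** b32)
      (a11 ** b13 + a12 ** b23 + a13 ** b33)
      (a21 ** b11 + a22 ** b21 + a23 ** b31) (a21 ** b12 + a22 ** b22 + a23 ** b32)
      (a21 ** b13 + a22 ** b23 + a23 ** b33)
      (a31 ** b11 + a32 ** b21 + a33 ** b31) (a31 ** b12 + a32 ** b22 + a33 ** b32)
      (a31 ** b13 + a32 ** b23 + a33 ** b33)"
  by (simp add: vec_eq_iff block3_def matrix_matrix_mult_def sum_UNIV_Plus add.assoc
      split: sum.splits)

lemma mat_1_block3: "mat 1 = block3 (mat 1) 0 0 0 (mat 1) 0 0 0 (mat 1)"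
  by (auto simp: vec_eq_iff block3_def mat_def split: sum.splits)

lemma block3_eq_iff:
  "block3 a11 a12 a13 a21 a22 a23 a31 a32 a33 = block3 b11 b12 b13 b21 b22 b23 b31 b32 b33 \<longleftrightarrow>
    a11 = b11 \<and> a12 = b12 \<and> a13 = b13 \<and> a21 = b21 \<and> a22 = b22 \<and> a23 = b23 \<and>
    a31 = b31 \<and> a32 = b32 \<and> a33 = b33"
  by (auto simp: vec_eq_iff block3_def split: sum.splits)

text \<open>The lower right block \<open>p4\<close> of the inverse solves
  \<open>M ** p4 = - d\<^sup>-\<^sup>1\<close> and \<open>p4 ** N = - b\<^sup>-\<^sup>1\<close>,
  where \<open>M\<close>, \<open>N\<close> are the two differences. This gives a right inverse of
  \<open>M\<close> and a left inverse of \<open>N\<close>; over a field, one side suffices for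
  square matrices.\<close>

lemma invertible_block2_imp:
  fixes a b d e :: "'a::field^'n^'n"
  assumes inv: "invertible a" "invertible b" "invertible d" and "invertible (block2 a b d e)"
  shows "invertible (a\<^sup>-\<^sup>1 ** b - d\<^sup>-\<^sup>1 ** e)" "invertible (d ** a\<^sup>-\<^sup>1 - e ** b\<^sup>-\<^sup>1)"
proof -
  obtain P where P: "block2 a b d e ** P = mat 1" "P ** block2 a b d e = mat 1"
    using assms by (auto simp: invertible_def)
  obtain p1 p2 p3 p4 where P_def: "P = block2 p1 p2 p3 p4"
    by (rule block2_cases)
  have r: "a ** p2 + b ** p4 = 0" "d ** p2 + e ** p4 = mat 1"
    and l: "p3 ** a + p4 ** d = 0" "p3 ** b + p4 ** e = mat 1"
    using P by (simp_all add: P_def block2_mult mat_1_block2[where 'a='a and 'b='n] block2_eq_iff)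
  have "(a\<^sup>-\<^sup>1 ** b - d\<^sup>-\<^sup>1 ** e) ** p4
      = a\<^sup>-\<^sup>1 ** (a ** p2 + b ** p4) - d\<^sup>-\<^sup>1 ** (d ** p2 + e ** p4)"
    using inv by (simp add: matrix_ring_simps matrix_inv_mult_cancel)
  then have "(a\<^sup>-\<^sup>1 ** b - d\<^sup>-\<^sup>1 ** e) ** p4 = - d\<^sup>-\<^sup>1"
    by (simp add: r)
  then have "(a\<^sup>-\<^sup>1 ** b - d\<^sup>-\<^sup>1 ** e) ** (- (p4 ** d)) = mat 1"
    using inv by (simp add: matrix_minus_left matrix_minus_right matrix_mul_assoc matrix_inv_mult_cancel)
  then show "invertible (a\<^sup>-\<^sup>1 ** b - d\<^sup>-\<^sup>1 ** e)"
    by (auto simp: invertible_right_inverse)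
  have "p4 ** (d ** a\<^sup>-\<^sup>1 - e ** b\<^sup>-\<^sup>1)
      = (p3 ** a + p4 ** d) ** a\<^sup>-\<^sup>1 - (p3 ** b + p4 ** e) ** b\<^sup>-\<^sup>1"
    using inv by (simp add: matrix_ring_simps matrix_inv_mult_cancel)
  then have "p4 ** (d ** a\<^sup>-\<^sup>1 - e ** b\<^sup>-\<^sup>1) = - b\<^sup>-\<^sup>1"
    by (simp add: l)
  then have "(- (b ** p4)) ** (d ** a\<^sup>-\<^sup>1 - e ** b\<^sup>-\<^sup>1) = mat 1"
    using inv by (simp add: matrix_minus_left matrix_minus_right matrix_mul_assoc[symmetric]
        matrix_inv_mult_cancel)
  then show "invertible (d ** a\<^sup>-\<^sup>1 - e ** b\<^sup>-\<^sup>1)"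
    by (auto simp: invertible_left_inverse)
qed

lemma matrix_mult_eq_0_iff:
  fixes A :: "'a::semiring_1^'n^'n"
  assumes "invertible A"
  shows "A ** X = 0 \<longleftrightarrow> X = 0" "Y ** A = 0 \<longleftrightarrow> Y = 0"
  using matrix_eq_inv_mult_iff[OF assms, of X 0] matrix_eq_mult_inv_iff[OF assms, of Y 0] by auto

lemma invertible_matrix_inv:
  fixes A :: "'a::semiring_1^'n^'n"
  assumes "invertible A"
  shows "invertible (A\<^sup>-\<^sup>1)"
  using matrix_inv[OF assms] by (auto simp: invertible_def)

section \<open>Elimination in the completion problem\<close>

locale completion =
  fixes a b c d e f g h i j k :: "'a::field^'n^'n"
  assumes inv: "invertible a" "invertible b" "invertible c" "invertible d" "invertible f"
    "invertible h" "invertible i" "invertible k"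
begin

definition M where "M = a\<^sup>-\<^sup>1 ** b - d\<^sup>-\<^sup>1 ** e"

definition N where "N = d ** a\<^sup>-\<^sup>1 - e ** b\<^sup>-\<^sup>1"

definition p where
  "p = - (a\<^sup>-\<^sup>1 ** h\<^sup>-\<^sup>1 ** i) + a\<^sup>-\<^sup>1 ** b ** j ** h\<^sup>-\<^sup>1 ** i - d\<^sup>-\<^sup>1 - d\<^sup>-\<^sup>1 ** e ** j ** h\<^sup>-\<^sup>1 ** i"

definition q where
  "q = - (k ** f\<^sup>-\<^sup>1 ** a\<^sup>-\<^sup>1) + k ** f\<^sup>-\<^sup>1 ** g ** d ** a\<^sup>-\<^sup>1 - b\<^sup>-\<^sup>1 - k ** f\<^sup>-\<^sup>1 ** g ** e ** b\<^sup>-\<^sup>1"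

text \<open>The last two conditions of the theorem are this one algebraic Riccati equation at
  \<open>q ** N\<^sup>-\<^sup>1\<close> and at \<open>M\<^sup>-\<^sup>1 ** p\<close>.\<close>

definition riccati where
  "riccati z \<longleftrightarrow> z = z ** e ** z + z ** d ** g + j ** b ** z - k ** c ** i + j ** a ** g"

definition inverse_pair where
  "inverse_pair t u v w x y z \<longleftrightarrow>
    block3 a t b u c v d w e ** block3 x f g h y i j k z = mat 1 \<and>
    block3 x f g h y i j k z ** block3 a t b u c v d w e = mat 1"

text \<open>Holds for arbitrary \<open>t\<close>, \<open>w\<close>, \<open>x\<close>,
  \<open>z\<close>: the brackets are the residuals of blocks (1,3), (3,3), (1,1), (3,1) of
  \<open>A ** B = mat 1\<close>. The differences remove \<open>g\<close> and \<open>x\<close>, and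
  the factor \<open>h\<^sup>-\<^sup>1 ** i\<close> makes \<open>t\<close> and \<open>w\<close>
  cancel. Keeping residuals lets the identity serve both directions: four equations give
  \<open>M ** z = p\<close>, and \<open>M ** z = p\<close> with three of them gives the
  fourth.\<close>

lemma M_mult_minus_p:
  "M ** z - p =
    a\<^sup>-\<^sup>1 ** (a ** g + t ** i + b ** z) - d\<^sup>-\<^sup>1 ** (d ** g + w ** i + e ** z - mat 1)
    - (a\<^sup>-\<^sup>1 ** (a ** x + t ** h + b ** j - mat 1) - d\<^sup>-\<^sup>1 ** (d ** x + w ** h + e ** j)) ** (h\<^sup>-\<^sup>1 ** i)"
  using inv by (simp add: M_def p_def matrix_ring_simps matrix_inv_mult_cancel)

text \<open>The mirror image for blocks (3,1), (3,3), (1,1), (1,3) of \<open>B ** A = mat 1\<close>: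
  \<open>j\<close> and \<open>x\<close> drop out of the differences, and
  \<open>k ** f\<^sup>-\<^sup>1\<close> makes \<open>u\<close> and \<open>v\<close> cancel.\<close>

lemma mult_N_minus_q:
  "z ** N - q =
    (j ** a + k ** u + z ** d) ** a\<^sup>-\<^sup>1 - (j ** b + k ** v + z ** e - mat 1) ** b\<^sup>-\<^sup>1
    - k ** f\<^sup>-\<^sup>1 ** ((x ** a + f ** u + g ** d - mat 1) ** a\<^sup>-\<^sup>1 - (x ** b + f ** v + g ** e) ** b\<^sup>-\<^sup>1)"
  using inv by (simp add: N_def q_def matrix_ring_simps matrix_inv_mult_cancel)

text \<open>The assumptions express \<open>k ** u\<close> and \<open>k ** v\<close> through
  \<open>z\<close>, which turns \<open>k\<close> times block (2,3) of \<open>A ** B\<close> into the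
  Riccati residual.\<close>

lemma riccati_iff:
  assumes "j ** a + k ** u + z ** d = 0" "j ** b + k ** v + z ** e = mat 1"
  shows "riccati z \<longleftrightarrow> u ** g + c ** i + v ** z = 0"
proof -
  have "k ** (u ** g + c ** i + v ** z)
      = (j ** a + k ** u + z ** d) ** g + (j ** b + k ** v + z ** e - mat 1) ** z
        + (z - (z ** e ** z + z ** d ** g + j ** b ** z - k ** c ** i + j ** a ** g))"
    by (simp add: matrix_ring_simps)
  then have "k ** (u ** g + c ** i + v ** z)
      = z - (z ** e ** z + z ** d ** g + j ** b ** z - k ** c ** i + j ** a ** g)"
    by (simp add: assms)
  moreover have "u ** g + c ** i + v ** z = 0 \<longleftrightarrow> k ** (u ** g + c ** i + v ** z) = 0"
    using inv by (simp add: matrix_mult_eq_0_iff)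
  ultimately show ?thesis
    unfolding riccati_def by (simp only: right_minus_eq)
qed

text \<open>Dually, block (3,2) of \<open>B ** A\<close> times \<open>i\<close> becomes the same
  residual.\<close>

lemma riccati_iff':
  assumes "a ** g + t ** i + b ** z = 0" "d ** g + w ** i + e ** z = mat 1"
  shows "riccati z \<longleftrightarrow> j ** t + k ** c + z ** w = 0"
proof -
  have "(j ** t + k ** c + z ** w) ** i
      = j ** (a ** g + t ** i + b ** z) + z ** (d ** g + w ** i + e ** z - mat 1)
        + (z - (z ** e ** z + z ** d ** g + j ** b ** z - k ** c ** i + j ** a ** g))"
    by (simp add: matrix_ring_simps)
  then have "(j ** t + k ** c + z ** w) ** i
      = z - (z ** e ** z + z ** d ** g + j ** b ** z - k ** c ** i + j ** a ** g)"
    by (simp add: assms)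
  moreover have "j ** t + k ** c + z ** w = 0 \<longleftrightarrow> (j ** t + k ** c + z ** w) ** i = 0"
    using inv by (simp add: matrix_mult_eq_0_iff)
  ultimately show ?thesis
    unfolding riccati_def by (simp only: right_minus_eq)
qed

text \<open>
  In \<open>inverse_pairI\<close>, evaluating the products \<open>R A C\<close>, with \<open>R\<close> a block row of \<open>B\<close> and \<open>C\<close> a block column, in both
  bracketings yields the block equations that are not assumed.
\<close>

lemma inverse_pairI:
  assumes z: "M ** z = p" "z ** N = q" "riccati z"
    and col3: "a ** g + t ** i + b ** z = 0" "d ** g + w ** i + e ** z = mat 1"
    and row3: "j ** a + k ** u + z ** d = 0" "j ** b + k ** v + z ** e = mat 1"
    and row1: "x ** a + f ** u + g ** d = mat 1"
    and y: "u ** f + c ** y + v ** k = mat 1"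
  shows "inverse_pair t u v w x y z"
proof -
  have col3': "u ** g + c ** i + v ** z = 0"
    using riccati_iff[OF row3] z by simp
  have row3': "j ** t + k ** c + z ** w = 0"
    using riccati_iff'[OF col3] z by simp
  \<comment> \<open>All residuals in \<open>mult_N_minus_q\<close> vanish except that of block (1,3)
    of \<open>B ** A\<close>.\<close>
  have "k ** f\<^sup>-\<^sup>1 ** ((x ** b + f ** v + g ** e) ** b\<^sup>-\<^sup>1) = 0"
    using mult_N_minus_q[of z u v x] z by (simp add: row3 row1 matrix_minus_right)
  then have row1': "x ** b + f ** v + g ** e = 0"
    using inv by (simp add: matrix_mult_eq_0_iff invertible_matrix_inv invertible_mult)
  \<comment> \<open>Row 1 of \<open>B\<close>, then \<open>A\<close>, then column 3 of
    \<open>B\<close>: only block (1,2) of \<open>B ** A\<close> is still unknown.\<close>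
  have "x ** (a ** g + t ** i + b ** z) + f ** (u ** g + c ** i + v ** z)
        + g ** (d ** g + w ** i + e ** z)
      = (x ** a + f ** u + g ** d) ** g + (x ** t + f ** c + g ** w) ** i
        + (x ** b + f ** v + g ** e) ** z"
    by (simp add: matrix_ring_simps)
  then have "(x ** t + f ** c + g ** w) ** i = 0"
    by (simp add: row1 row1' col3 col3')
  then have row1'': "x ** t + f ** c + g ** w = 0"
    using inv by (simp add: matrix_mult_eq_0_iff)
  \<comment> \<open>\<open>x\<close> comes from block (1,1) of \<open>B ** A\<close>, whereas
    \<open>x'\<close> is chosen to solve block (1,1) of \<open>A ** B\<close>; they are identified
    only after column 1 has been verified with \<open>x'\<close>.\<close>
  define x' where "x' = a\<^sup>-\<^sup>1 ** (mat 1 - t ** h - b ** j)"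
  have ax': "a ** x' + t ** h + b ** j = mat 1"
    using inv by (simp add: x'_def matrix_ring_simps matrix_inv_mult_cancel)
  have "d\<^sup>-\<^sup>1 ** (d ** x' + w ** h + e ** j) ** (h\<^sup>-\<^sup>1 ** i) = 0"
    using M_mult_minus_p[of z t w x'] z by (simp add: col3 ax' matrix_minus_left)
  then have dx': "d ** x' + w ** h + e ** j = 0"
    using inv by (simp add: matrix_mult_eq_0_iff invertible_matrix_inv invertible_mult)
  \<comment> \<open>Row 3 of \<open>B\<close> against column 1 with \<open>x'\<close> isolates block
    (2,1) of \<open>A ** B\<close>.\<close>
  have "j ** (a ** x' + t ** h + b ** j) + k ** (u ** x' + c ** h + v ** j)
        + z ** (d ** x' + w ** h + e ** j)
      = (j ** a + k ** u + z ** d) ** x' + (j ** t + k ** c + z ** w) ** h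
        + (j ** b + k ** v + z ** e) ** j"
    by (simp add: matrix_ring_simps)
  then have "k ** (u ** x' + c ** h + v ** j) = 0"
    by (simp add: ax' dx' row3 row3')
  then have ux': "u ** x' + c ** h + v ** j = 0"
    using inv by (simp add: matrix_mult_eq_0_iff)
  \<comment> \<open>Row 1 of \<open>B\<close> against the same column: the left side collapses to
    \<open>x\<close>, the right side to \<open>x'\<close>.\<close>
  have "x ** (a ** x' + t ** h + b ** j) + f ** (u ** x' + c ** h + v ** j)
        + g ** (d ** x' + w ** h + e ** j)
      = (x ** a + f ** u + g ** d) ** x' + (x ** t + f ** c + g ** w) ** h
        + (x ** b + f ** v + g ** e) ** j"
    by (simp add: matrix_ring_simps)
  then have "x' = x"
    by (simp add: ax' ux' dx' row1 row1' row1'')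
  with ax' ux' dx' have col1: "a ** x + t ** h + b ** j = mat 1"
    "u ** x + c ** h + v ** j = 0" "d ** x + w ** h + e ** j = 0"
    by simp_all
  \<comment> \<open>Likewise \<open>y\<close> solves block (2,2) of \<open>A ** B\<close>, and
    \<open>y'\<close> that of \<open>B ** A\<close>.\<close>
  define y' where "y' = (mat 1 - h ** t - i ** w) ** c\<^sup>-\<^sup>1"
  have row2: "h ** t + y' ** c + i ** w = mat 1"
    using inv by (simp add: y'_def matrix_ring_simps matrix_inv_mult_cancel)
  \<comment> \<open>The formula for the middle column, multiplied by \<open>c\<close> and by an
    arbitrary block row \<open>(l, m, n)\<close>; the rows of \<open>A\<close> are inserted
    next.\<close>
  have col2_mult_c: "(l ** f + m ** y' + n ** k) ** c = m
      - (l ** x + m ** h + n ** j) ** t - (l ** g + m ** i + n ** z) ** w" for l m n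
  proof -
    have "(l ** f + m ** y' + n ** k) ** c
        = l ** (x ** t + f ** c + g ** w) + m ** (h ** t + y' ** c + i ** w)
          + n ** (j ** t + k ** c + z ** w)
          - (l ** x + m ** h + n ** j) ** t - (l ** g + m ** i + n ** z) ** w"
      by (simp add: matrix_ring_simps)
    then show ?thesis
      by (simp add: row1'' row2 row3')
  qed
  have "(a ** f + t ** y' + b ** k) ** c = 0" "(d ** f + w ** y' + e ** k) ** c = 0"
    "(u ** f + c ** y' + v ** k - mat 1) ** c = 0"
    by (simp_all add: col2_mult_c matrix_diff_rdistrib col1 col3 col3')
  then have col2': "a ** f + t ** y' + b ** k = 0" "d ** f + w ** y' + e ** k = 0"
    "u ** f + c ** y' + v ** k = mat 1"
    using inv by (simp_all add: matrix_mult_eq_0_iff)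
  have "c ** (y' - y) = (u ** f + c ** y' + v ** k) - (u ** f + c ** y + v ** k)"
    by (simp add: matrix_ring_simps)
  then have "y' = y"
    using inv by (simp add: col2' y matrix_mult_eq_0_iff)
  then have "block3 a t b u c v d w e ** block3 x f g h y i j k z = mat 1"
    using col1 col2' col3 col3' by (simp add: block3_mult mat_1_block3[where 'b='n] block3_eq_iff)
  \<comment> \<open>A right inverse of a square matrix over a field is also a left inverse.\<close>
  then show ?thesis
    using matrix_left_right_inverse by (auto simp: inverse_pair_def)
qed

text \<open>The system becomes triangular: three conditions on \<open>z\<close> alone, linear
  equations giving \<open>t\<close>, \<open>w\<close>, \<open>u\<close>, \<open>v\<close> from
  \<open>z\<close>, then \<open>x\<close> from \<open>u\<close> and \<open>y\<close> from
  \<open>u\<close>, \<open>v\<close>.\<close>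

lemma inverse_pair_iff:
  "inverse_pair t u v w x y z \<longleftrightarrow>
    M ** z = p \<and> z ** N = q \<and> riccati z \<and>
    a ** g + t ** i + b ** z = 0 \<and> d ** g + w ** i + e ** z = mat 1 \<and>
    j ** a + k ** u + z ** d = 0 \<and> j ** b + k ** v + z ** e = mat 1 \<and>
    x ** a + f ** u + g ** d = mat 1 \<and> u ** f + c ** y + v ** k = mat 1"
proof (intro iffI; (elim conjE)?)
  assume "inverse_pair t u v w x y z"
  then have
    AB: "a ** x + t ** h + b ** j = mat 1" "a ** g + t ** i + b ** z = 0"
      "u ** f + c ** y + v ** k = mat 1" "u ** g + c ** i + v ** z = 0"
      "d ** x + w ** h + e ** j = 0" "d ** g + w ** i + e ** z = mat 1"
    and BA: "x ** a + f ** u + g ** d = mat 1" "x ** b + f ** v + g ** e = 0"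
      "j ** a + k ** u + z ** d = 0" "j ** b + k ** v + z ** e = mat 1"
    by (simp_all add: inverse_pair_def block3_mult mat_1_block3[where 'b='n] block3_eq_iff)
  have "M ** z - p = 0"
    by (simp add: M_mult_minus_p[of z t w x] AB)
  moreover have "z ** N - q = 0"
    by (simp add: mult_N_minus_q[of z u v x] BA)
  moreover have "riccati z"
    using riccati_iff AB BA by simp
  ultimately show "M ** z = p \<and> z ** N = q \<and> riccati z \<and>
    a ** g + t ** i + b ** z = 0 \<and> d ** g + w ** i + e ** z = mat 1 \<and>
    j ** a + k ** u + z ** d = 0 \<and> j ** b + k ** v + z ** e = mat 1 \<and>
    x ** a + f ** u + g ** d = mat 1 \<and> u ** f + c ** y + v ** k = mat 1"
    using AB BA by simp
qed (rule inverse_pairI)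

section \<open>Explicit formulas for the unknown blocks\<close>

lemma t_eq_iff: "t = - (a ** g ** i\<^sup>-\<^sup>1) - b ** z ** i\<^sup>-\<^sup>1 \<longleftrightarrow> a ** g + t ** i + b ** z = 0"
proof -
  have "t = - (a ** g ** i\<^sup>-\<^sup>1) - b ** z ** i\<^sup>-\<^sup>1 \<longleftrightarrow> t = (- (a ** g) - b ** z) ** i\<^sup>-\<^sup>1"
    by (simp add: matrix_ring_simps)
  also have "\<dots> \<longleftrightarrow> t ** i = - (a ** g) - b ** z"
    using inv by (simp only: matrix_eq_mult_inv_iff)
  finally show ?thesis
    by (simp add: eq_diff_eq ac_simps eq_neg_iff_add_eq_0)
qed

lemma w_eq_iff:
  "w = i\<^sup>-\<^sup>1 - d ** g ** i\<^sup>-\<^sup>1 - e ** z ** i\<^sup>-\<^sup>1 \<longleftrightarrow> d ** g + w ** i + e ** z = mat 1"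
proof -
  have "w = i\<^sup>-\<^sup>1 - d ** g ** i\<^sup>-\<^sup>1 - e ** z ** i\<^sup>-\<^sup>1 \<longleftrightarrow> w = (mat 1 - d ** g - e ** z) ** i\<^sup>-\<^sup>1"
    by (simp add: matrix_ring_simps)
  also have "\<dots> \<longleftrightarrow> w ** i = mat 1 - d ** g - e ** z"
    using inv by (simp only: matrix_eq_mult_inv_iff)
  finally show ?thesis
    by (simp add: eq_diff_eq ac_simps)
qed

lemma u_eq_iff: "u = - (k\<^sup>-\<^sup>1 ** j ** a) - k\<^sup>-\<^sup>1 ** z ** d \<longleftrightarrow> j ** a + k ** u + z ** d = 0"
proof -
  have "u = - (k\<^sup>-\<^sup>1 ** j ** a) - k\<^sup>-\<^sup>1 ** z ** d \<longleftrightarrow> u = k\<^sup>-\<^sup>1 ** (- (j ** a) - z ** d)"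
    by (simp add: matrix_ring_simps)
  also have "\<dots> \<longleftrightarrow> k ** u = - (j ** a) - z ** d"
    using inv by (simp only: matrix_eq_inv_mult_iff)
  finally show ?thesis
    by (simp add: eq_diff_eq ac_simps eq_neg_iff_add_eq_0)
qed

lemma v_eq_iff:
  "v = k\<^sup>-\<^sup>1 - k\<^sup>-\<^sup>1 ** j ** b - k\<^sup>-\<^sup>1 ** z ** e \<longleftrightarrow> j ** b + k ** v + z ** e = mat 1"
proof -
  have "v = k\<^sup>-\<^sup>1 - k\<^sup>-\<^sup>1 ** j ** b - k\<^sup>-\<^sup>1 ** z ** e \<longleftrightarrow> v = k\<^sup>-\<^sup>1 ** (mat 1 - j ** b - z ** e)"
    by (simp add: matrix_ring_simps)
  also have "\<dots> \<longleftrightarrow> k ** v = mat 1 - j ** b - z ** e"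
    using inv by (simp only: matrix_eq_inv_mult_iff)
  finally show ?thesis
    by (simp add: eq_diff_eq ac_simps)
qed

lemma x_eq_iff:
  assumes "u = - (k\<^sup>-\<^sup>1 ** j ** a) - k\<^sup>-\<^sup>1 ** z ** d"
  shows "x = a\<^sup>-\<^sup>1 + f ** k\<^sup>-\<^sup>1 ** j - g ** d ** a\<^sup>-\<^sup>1 + f ** k\<^sup>-\<^sup>1 ** z ** d ** a\<^sup>-\<^sup>1 \<longleftrightarrow>
    x ** a + f ** u + g ** d = mat 1"
proof -
  have "a\<^sup>-\<^sup>1 + f ** k\<^sup>-\<^sup>1 ** j - g ** d ** a\<^sup>-\<^sup>1 + f ** k\<^sup>-\<^sup>1 ** z ** d ** a\<^sup>-\<^sup>1
      = (mat 1 - f ** u - g ** d) ** a\<^sup>-\<^sup>1"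
    using inv by (simp add: assms matrix_ring_simps matrix_inv_mult_cancel)
  also have "x = \<dots> \<longleftrightarrow> x ** a = mat 1 - f ** u - g ** d"
    using inv by (simp only: matrix_eq_mult_inv_iff)
  finally show ?thesis
    by (simp add: eq_diff_eq ac_simps)
qed

lemma y_eq_iff:
  assumes "u = - (k\<^sup>-\<^sup>1 ** j ** a) - k\<^sup>-\<^sup>1 ** z ** d" "v = k\<^sup>-\<^sup>1 - k\<^sup>-\<^sup>1 ** j ** b - k\<^sup>-\<^sup>1 ** z ** e"
  shows "y = c\<^sup>-\<^sup>1 ** k\<^sup>-\<^sup>1 ** j ** a ** f + c\<^sup>-\<^sup>1 ** k\<^sup>-\<^sup>1 ** j ** b ** k
      + c\<^sup>-\<^sup>1 ** k\<^sup>-\<^sup>1 ** z ** d ** f + c\<^sup>-\<^sup>1 ** k\<^sup>-\<^sup>1 ** z ** e ** k \<longleftrightarrow>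
    u ** f + c ** y + v ** k = mat 1"
proof -
  have "c\<^sup>-\<^sup>1 ** k\<^sup>-\<^sup>1 ** j ** a ** f + c\<^sup>-\<^sup>1 ** k\<^sup>-\<^sup>1 ** j ** b ** k
      + c\<^sup>-\<^sup>1 ** k\<^sup>-\<^sup>1 ** z ** d ** f + c\<^sup>-\<^sup>1 ** k\<^sup>-\<^sup>1 ** z ** e ** k
      = c\<^sup>-\<^sup>1 ** (mat 1 - u ** f - v ** k)"
    using inv by (simp add: assms matrix_ring_simps matrix_inv_mult_cancel)
  also have "y = \<dots> \<longleftrightarrow> c ** y = mat 1 - u ** f - v ** k"
    using inv by (simp only: matrix_eq_inv_mult_iff)
  finally show ?thesis
    by (simp add: eq_diff_eq ac_simps)
qed

lemma inverse_pair_iff_explicit: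
  "inverse_pair t u v w x y z \<longleftrightarrow>
    M ** z = p \<and> z ** N = q \<and> riccati z \<and>
    t = - (a ** g ** i\<^sup>-\<^sup>1) - b ** z ** i\<^sup>-\<^sup>1 \<and>
    u = - (k\<^sup>-\<^sup>1 ** j ** a) - k\<^sup>-\<^sup>1 ** z ** d \<and>
    v = k\<^sup>-\<^sup>1 - k\<^sup>-\<^sup>1 ** j ** b - k\<^sup>-\<^sup>1 ** z ** e \<and>
    w = i\<^sup>-\<^sup>1 - d ** g ** i\<^sup>-\<^sup>1 - e ** z ** i\<^sup>-\<^sup>1 \<and>
    x = a\<^sup>-\<^sup>1 + f ** k\<^sup>-\<^sup>1 ** j - g ** d ** a\<^sup>-\<^sup>1 + f ** k\<^sup>-\<^sup>1 ** z ** d ** a\<^sup>-\<^sup>1 \<and>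
    y = c\<^sup>-\<^sup>1 ** k\<^sup>-\<^sup>1 ** j ** a ** f + c\<^sup>-\<^sup>1 ** k\<^sup>-\<^sup>1 ** j ** b ** k
        + c\<^sup>-\<^sup>1 ** k\<^sup>-\<^sup>1 ** z ** d ** f + c\<^sup>-\<^sup>1 ** k\<^sup>-\<^sup>1 ** z ** e ** k"
  unfolding inverse_pair_iff t_eq_iff[symmetric] u_eq_iff[symmetric] v_eq_iff[symmetric]
    w_eq_iff[symmetric]
  \<comment> \<open>The formulas for \<open>x\<close> and \<open>y\<close> have \<open>u\<close> and
    \<open>v\<close> already substituted, so these equivalences apply only under the preceding
    conjuncts.\<close>
  using x_eq_iff[of u z x] y_eq_iff[of u z v y] by blast

end

section \<open>Solvability criterion and the form of the solution\<close>

theorem theorem2: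
  fixes a b c d e f g h i j k :: "('a::field)^('n::finite)^'n"
    and p q M N :: "'a^'n^'n"
    and inverse_pair ::
      "'a^'n^'n \<Rightarrow> 'a^'n^'n \<Rightarrow> 'a^'n^'n \<Rightarrow> 'a^'n^'n \<Rightarrow> 'a^'n^'n \<Rightarrow> 'a^'n^'n \<Rightarrow> 'a^'n^'n \<Rightarrow> bool"
  defines "inverse_pair \<equiv> \<lambda>t u v w x y z.
      (let A = block3 a t b
                      u c v
                      d w e;
           B = block3 x f g
                      h y i
                      j k z
       in A ** B = mat 1 \<and> B ** A = mat 1)"
    and "p \<equiv> - (a\<^sup>-\<^sup>1 ** h\<^sup>-\<^sup>1 ** i) + a\<^sup>-\<^sup>1 ** b ** j ** h\<^sup>-\<^sup>1 ** i - d\<^sup>-\<^sup>1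
             - d\<^sup>-\<^sup>1 ** e ** j ** h\<^sup>-\<^sup>1 ** i"
    and "q \<equiv> - (k ** f\<^sup>-\<^sup>1 ** a\<^sup>-\<^sup>1) + k ** f\<^sup>-\<^sup>1 ** g ** d ** a\<^sup>-\<^sup>1 - b\<^sup>-\<^sup>1
             - k ** f\<^sup>-\<^sup>1 ** g ** e ** b\<^sup>-\<^sup>1"
    and "M \<equiv> a\<^sup>-\<^sup>1 ** b - d\<^sup>-\<^sup>1 ** e"
    and "N \<equiv> d ** a\<^sup>-\<^sup>1 - e ** b\<^sup>-\<^sup>1"
  assumes "invertible a" "invertible b" "invertible c" "invertible d" "invertible e"
    and "invertible f" "invertible g" "invertible h" "invertible i" "invertible j" "invertible k"
    and "invertible (block2 a b
                            d e)"
  shows "invertible M \<and> invertible N \<and>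
        ((\<exists>t u v w x y z. inverse_pair t u v w x y z) \<longleftrightarrow>
          p ** N = M ** q \<and>
          q ** N\<^sup>-\<^sup>1 = q ** N\<^sup>-\<^sup>1 ** e ** q ** N\<^sup>-\<^sup>1 + q ** N\<^sup>-\<^sup>1 ** d ** g
                     + j ** b ** q ** N\<^sup>-\<^sup>1 - k ** c ** i + j ** a ** g \<and>
          M\<^sup>-\<^sup>1 ** p = M\<^sup>-\<^sup>1 ** p ** e ** M\<^sup>-\<^sup>1 ** p + M\<^sup>-\<^sup>1 ** p ** d ** g
                     + j ** b ** M\<^sup>-\<^sup>1 ** p - k ** c ** i + j ** a ** g) \<and>
        ((\<exists>t u v w x y z. inverse_pair t u v w x y z) \<longrightarrow>
          M\<^sup>-\<^sup>1 ** p = q ** N\<^sup>-\<^sup>1 \<and>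
          (\<forall>t u v w x y z. inverse_pair t u v w x y z \<longleftrightarrow>
            z = M\<^sup>-\<^sup>1 ** p \<and>
            t = - (a ** g ** i\<^sup>-\<^sup>1) - b ** z ** i\<^sup>-\<^sup>1 \<and>
            u = - (k\<^sup>-\<^sup>1 ** j ** a) - k\<^sup>-\<^sup>1 ** z ** d \<and>
            v = k\<^sup>-\<^sup>1 - k\<^sup>-\<^sup>1 ** j ** b - k\<^sup>-\<^sup>1 ** z ** e \<and>
            w = i\<^sup>-\<^sup>1 - d ** g ** i\<^sup>-\<^sup>1 - e ** z ** i\<^sup>-\<^sup>1 \<and>
            x = a\<^sup>-\<^sup>1 + f ** k\<^sup>-\<^sup>1 ** j - g ** d ** a\<^sup>-\<^sup>1 + f ** k\<^sup>-\<^sup>1 ** z ** d ** a\<^sup>-\<^sup>1 \<and>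
            y = c\<^sup>-\<^sup>1 ** k\<^sup>-\<^sup>1 ** j ** a ** f + c\<^sup>-\<^sup>1 ** k\<^sup>-\<^sup>1 ** j ** b ** k
                + c\<^sup>-\<^sup>1 ** k\<^sup>-\<^sup>1 ** z ** d ** f + c\<^sup>-\<^sup>1 ** k\<^sup>-\<^sup>1 ** z ** e ** k))"
proof -
  interpret C: completion a b c d e f g h i j k
    using assms by unfold_locales
  have M: "M = C.M" and N: "N = C.N" and p: "p = C.p" and q: "q = C.q"
    by (simp_all add: M_def N_def p_def q_def C.M_def C.N_def C.p_def C.q_def)
  have M_inv: "invertible M" and N_inv: "invertible N"
    using invertible_block2_imp[of a b d e] assms(6-) by (simp_all add: M_def N_def)
  let ?z = "M\<^sup>-\<^sup>1 ** p"
  have pair: "inverse_pair t u v w x y z \<longleftrightarrow> C.inverse_pair t u v w x y z" for t u v w x y z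
    by (simp add: inverse_pair_def C.inverse_pair_def Let_def)
  have left: "M ** z = p \<longleftrightarrow> z = ?z" and right: "z ** N = q \<longleftrightarrow> z = q ** N\<^sup>-\<^sup>1" for z
    using matrix_eq_inv_mult_iff[OF M_inv] matrix_eq_mult_inv_iff[OF N_inv] by blast+
  \<comment> \<open>The first condition says exactly that the two candidates for \<open>z\<close>
    coincide.\<close>
  have compat: "p ** N = M ** q \<longleftrightarrow> ?z = q ** N\<^sup>-\<^sup>1"
  proof -
    have "?z = q ** N\<^sup>-\<^sup>1 \<longleftrightarrow> M\<^sup>-\<^sup>1 ** (p ** N) = q"
      using right[of ?z] by (simp add: matrix_mul_assoc)
    then show ?thesis
      using matrix_eq_inv_mult_iff[OF M_inv, of q "p ** N"] by metis
  qed
  \<comment> \<open>\<open>z\<close> must equal both candidates, and the other unknowns are given by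
    formulas in \<open>z\<close>, so existence depends on \<open>z\<close> alone.\<close>
  have sol: "(\<exists>t u v w x y z. inverse_pair t u v w x y z) \<longleftrightarrow> ?z = q ** N\<^sup>-\<^sup>1 \<and> C.riccati ?z"
    unfolding pair C.inverse_pair_iff_explicit M[symmetric] N[symmetric] p[symmetric]
      q[symmetric] left right by auto
  have ric: "C.riccati (M\<^sup>-\<^sup>1 ** p) \<longleftrightarrow>
      M\<^sup>-\<^sup>1 ** p = M\<^sup>-\<^sup>1 ** p ** e ** M\<^sup>-\<^sup>1 ** p + M\<^sup>-\<^sup>1 ** p ** d ** g
        + j ** b ** M\<^sup>-\<^sup>1 ** p - k ** c ** i + j ** a ** g"
    "C.riccati (q ** N\<^sup>-\<^sup>1) \<longleftrightarrow>
      q ** N\<^sup>-\<^sup>1 = q ** N\<^sup>-\<^sup>1 ** e ** q ** N\<^sup>-\<^sup>1 + q ** N\<^sup>-\<^sup>1 ** d ** g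
        + j ** b ** q ** N\<^sup>-\<^sup>1 - k ** c ** i + j ** a ** g"
    by (simp_all add: C.riccati_def matrix_mul_assoc)
  \<comment> \<open>Once the candidates agree, the two Riccati conditions are the same, and
    \<open>z = ?z\<close> determines the whole solution.\<close>
  show ?thesis
    unfolding ric[symmetric] sol compat
    unfolding pair C.inverse_pair_iff_explicit M[symmetric] N[symmetric] p[symmetric]
      q[symmetric] left right
    using M_inv N_inv by auto
qed

end
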